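(* Let $n\ge 3$, let $a_0,\ldots,a_{n-1}$ be indeterminates over $\mathbb{Q}$, and let $f=x^n+a_{n-1}x^{n-1}+\cdots+a_0$ with roots $r_1,\ldots,r_n$. Let $D_2\in\mathbb{Q}[a_0,\ldots,a_{n-1}]$ be the polynomial obtained by expressing $\prod_{1\le i,j,k\le n,\ i<j,\ j\ne k,\ k\ne i}(2r_k-r_i-r_j)$ in terms of $a_0,\ldots,a_{n-1}$ via Vieta's formulas. Then the total degree of $D_2$ in $(a_0,\ldots,a_{n-1})$ is $3(n-1)(n-2)/2$. *)

theory Defs
  imports "HOL-Library.Poly_Mapping" "HOL-Computational_Algebra.Polynomial"
begin

text \<open>Multivariate polynomials over the rationals in the variables indexed by nat:
  a polynomial maps monomials (finitely supported exponent vectors) to coefficients.\<close>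
type_synonym mpoly = "(nat \<Rightarrow>\<^sub>0 nat) \<Rightarrow>\<^sub>0 rat"

definition mvar :: "nat \<Rightarrow> mpoly" where
  "mvar i = Poly_Mapping.single (Poly_Mapping.single i 1) 1"

definition mconst :: "rat \<Rightarrow> mpoly" where
  "mconst c = Poly_Mapping.single 0 c"

definition mvars :: "mpoly \<Rightarrow> nat set" where
  "mvars p = \<Union> (Poly_Mapping.keys ` Poly_Mapping.keys p)"

text \<open>Total degree of a monomial and of a polynomial (0 for the zero polynomial).\<close>
definition mon_deg :: "(nat \<Rightarrow>\<^sub>0 nat) \<Rightarrow> nat" where
  "mon_deg m = (\<Sum>v\<in>Poly_Mapping.keys m. Poly_Mapping.lookup m v)"

definition total_degree :: "mpoly \<Rightarrow> nat" where
  "total_degree p = Max (insert 0 (mon_deg ` Poly_Mapping.keys p))"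

definition msubst :: "(nat \<Rightarrow> mpoly) \<Rightarrow> mpoly \<Rightarrow> mpoly" where
  "msubst \<sigma> p = (\<Sum>m\<in>Poly_Mapping.keys p.
      mconst (Poly_Mapping.lookup p m) *
      (\<Prod>v\<in>Poly_Mapping.keys m. \<sigma> v ^ Poly_Mapping.lookup m v))"

text \<open>Vieta: with roots r_0,...,r_{n-1} (variables mvar 0 .. mvar (n-1)),
  a_i is the i-th coefficient of prod_k (x - r_k) = x^n + a_{n-1} x^{n-1} + ... + a_0.\<close>
definition vieta_coeff :: "nat \<Rightarrow> nat \<Rightarrow> mpoly" where
  "vieta_coeff n i = coeff (\<Prod>k<n. [:- mvar k, 1:]) i"

definition D2_roots :: "nat \<Rightarrow> mpoly" where
  "D2_roots n = (\<Prod>(i, j, k) \<in> {(i, j, k). i < j \<and> j < n \<and> k < n \<and> k \<noteq> i \<and> k \<noteq> j}.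
      2 * mvar k - mvar i - mvar j)"

text \<open>D is a polynomial in a_0..a_{n-1} (variables 0..n-1) expressing D2_roots n via Vieta.\<close>
definition is_D2 :: "nat \<Rightarrow> mpoly \<Rightarrow> bool" where
  "is_D2 n D \<longleftrightarrow> mvars D \<subseteq> {..<n} \<and> msubst (vieta_coeff n) D = D2_roots n"

end

theory Submission
  imports Defs "HOL-Combinatorics.Transposition" "HOL-Computational_Algebra.Fundamental_Theorem_Algebra"
begin

text \<open>A polynomial in the coefficients of \<open>f\<close> has total degree equal to the degree, in a single root, of
  the symmetric polynomial it represents. Indeed \<open>a\<^sub>i = b\<^sub>i\<^sub>-\<^sub>1 - r b\<^sub>i\<close>, where \<open>r\<close> is the root singled out and the
  \<open>b\<^sub>i\<close> are the coefficients of the monic polynomial with the remaining roots; so the coefficient of the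
  top power of \<open>r\<close> is the top homogeneous part evaluated at the \<open>- b\<^sub>i\<close>. Over the complex numbers the
  \<open>b\<^sub>i\<close> below the leading one can be prescribed freely, hence this coefficient does not vanish identically.
  In the given product, the factors that involve a fixed root are linear in it, and counting them gives the
  degree. That the product is a polynomial in the coefficients follows from the fundamental theorem
  on symmetric polynomials, proved by adjoining the roots one at a time.\<close>

section \<open>Evaluation of multivariate polynomials\<close>

definition mon_eval :: "(nat \<Rightarrow> 'a::comm_ring_1) \<Rightarrow> (nat \<Rightarrow>\<^sub>0 nat) \<Rightarrow> 'a" where
  "mon_eval \<sigma> m = (\<Prod>v\<in>Poly_Mapping.keys m. \<sigma> v ^ Poly_Mapping.lookup m v)"

definition meval :: "(rat \<Rightarrow> 'a::comm_ring_1) \<Rightarrow> (nat \<Rightarrow> 'a) \<Rightarrow> mpoly \<Rightarrow> 'a" where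
  "meval h \<sigma> p = (\<Sum>m\<in>Poly_Mapping.keys p. h (Poly_Mapping.lookup p m) * mon_eval \<sigma> m)"

lemma mon_eval_superset:
  assumes "finite A" "Poly_Mapping.keys m \<subseteq> A"
  shows "mon_eval \<sigma> m = (\<Prod>v\<in>A. \<sigma> v ^ Poly_Mapping.lookup m v)"
  unfolding mon_eval_def using assms
  by (intro prod.mono_neutral_left) (auto simp: in_keys_iff)

lemma mon_eval_0 [simp]: "mon_eval \<sigma> 0 = 1"
  by (simp add: mon_eval_def)

lemma mon_eval_single [simp]: "mon_eval \<sigma> (Poly_Mapping.single v k) = \<sigma> v ^ k"
  by (simp add: mon_eval_def)

lemma mon_eval_add: "mon_eval \<sigma> (m + m') = mon_eval \<sigma> m * mon_eval \<sigma> m'"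
proof -
  let ?A = "Poly_Mapping.keys m \<union> Poly_Mapping.keys m'"
  have "mon_eval \<sigma> (m + m') = (\<Prod>v\<in>?A. \<sigma> v ^ Poly_Mapping.lookup (m + m') v)"
    by (intro mon_eval_superset keys_add) auto
  also have "\<dots> = (\<Prod>v\<in>?A. \<sigma> v ^ Poly_Mapping.lookup m v) * (\<Prod>v\<in>?A. \<sigma> v ^ Poly_Mapping.lookup m' v)"
    by (simp add: lookup_add power_add prod.distrib)
  also have "\<dots> = mon_eval \<sigma> m * mon_eval \<sigma> m'"
    by (simp add: mon_eval_superset[of ?A])
  finally show ?thesis .
qed

lemma poly_mapping_eq_sum_single:
  "(\<Sum>m\<in>Poly_Mapping.keys p. Poly_Mapping.single m (Poly_Mapping.lookup p m)) = p"
  for p :: "'a \<Rightarrow>\<^sub>0 'b::comm_monoid_add"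
  by (rule poly_mapping_eqI) (auto simp: lookup_sum lookup_single when_def in_keys_iff)

text \<open>Covers both targets used below: with \<open>mconst\<close>, \<open>meval\<close> is the
  substitution \<open>msubst\<close>; with rationals embedded as constant complex polynomials, it
  yields the specialisation to one free root.\<close>

locale coeff_hom =
  fixes h :: "rat \<Rightarrow> 'a::comm_ring_1"
  assumes hom_0: "h 0 = 0" and hom_1: "h 1 = 1"
    and hom_add: "h (x + y) = h x + h y" and hom_mult: "h (x * y) = h x * h y"
begin

lemma meval_superset:
  assumes "finite A" "Poly_Mapping.keys p \<subseteq> A"
  shows "meval h \<sigma> p = (\<Sum>m\<in>A. h (Poly_Mapping.lookup p m) * mon_eval \<sigma> m)"
  unfolding meval_def using assms
  by (intro sum.mono_neutral_left) (auto simp: in_keys_iff hom_0)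

lemma meval_0 [simp]: "meval h \<sigma> 0 = 0"
  by (simp add: meval_def)

lemma meval_single: "meval h \<sigma> (Poly_Mapping.single m c) = h c * mon_eval \<sigma> m"
  by (simp add: meval_def hom_0)

lemma meval_1 [simp]: "meval h \<sigma> 1 = 1"
  using meval_single[of \<sigma> 0 1] by (simp add: hom_1)

lemma meval_mvar [simp]: "meval h \<sigma> (mvar v) = \<sigma> v"
  by (simp add: mvar_def meval_single hom_1)

lemma meval_mconst [simp]: "meval h \<sigma> (mconst c) = h c"
  by (simp add: mconst_def meval_single)

lemma meval_add [simp]: "meval h \<sigma> (p + q) = meval h \<sigma> p + meval h \<sigma> q"
proof -
  let ?A = "Poly_Mapping.keys p \<union> Poly_Mapping.keys q"
  have "meval h \<sigma> (p + q) = (\<Sum>m\<in>?A. h (Poly_Mapping.lookup (p + q) m) * mon_eval \<sigma> m)"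
    by (intro meval_superset keys_add) auto
  also have "\<dots> = meval h \<sigma> p + meval h \<sigma> q"
    by (simp add: meval_superset[of ?A] lookup_add hom_add distrib_right sum.distrib)
  finally show ?thesis .
qed

lemma meval_uminus [simp]: "meval h \<sigma> (- p) = - meval h \<sigma> p"
  by (rule minus_unique[symmetric]) (simp flip: meval_add)

lemma meval_diff [simp]: "meval h \<sigma> (p - q) = meval h \<sigma> p - meval h \<sigma> q"
  using meval_add[of \<sigma> p "- q"] by simp

lemma meval_sum: "meval h \<sigma> (\<Sum>x\<in>A. f x) = (\<Sum>x\<in>A. meval h \<sigma> (f x))"
  by (induction A rule: infinite_finite_induct) auto

lemma meval_mult [simp]: "meval h \<sigma> (p * q) = meval h \<sigma> p * meval h \<sigma> q"
proof -
  let ?K = "Poly_Mapping.keys" and ?l = "Poly_Mapping.lookup"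
  have "p * q = (\<Sum>m\<in>?K p. Poly_Mapping.single m (?l p m)) * (\<Sum>m\<in>?K q. Poly_Mapping.single m (?l q m))"
    by (simp only: poly_mapping_eq_sum_single)
  also have "\<dots> = (\<Sum>m\<in>?K p. \<Sum>m'\<in>?K q. Poly_Mapping.single (m + m') (?l p m * ?l q m'))"
    by (simp only: sum_product mult_single)
  also have "meval h \<sigma> \<dots>
      = (\<Sum>m\<in>?K p. \<Sum>m'\<in>?K q. h (?l p m) * mon_eval \<sigma> m * (h (?l q m') * mon_eval \<sigma> m'))"
    by (simp only: meval_sum meval_single hom_mult mon_eval_add mult_ac)
  also have "\<dots> = meval h \<sigma> p * meval h \<sigma> q"
    by (simp only: sum_product meval_def)
  finally show ?thesis .
qed

lemma meval_prod: "meval h \<sigma> (\<Prod>x\<in>A. f x) = (\<Prod>x\<in>A. meval h \<sigma> (f x))"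
  by (induction A rule: infinite_finite_induct) auto

lemma meval_power: "meval h \<sigma> (p ^ k) = meval h \<sigma> p ^ k"
  by (induction k) auto

lemma meval_2 [simp]: "meval h \<sigma> 2 = 2"
  using meval_add[of \<sigma> 1 1] by (simp del: meval_add)

end

interpretation mconst: coeff_hom mconst
  by standard (simp_all add: mconst_def single_add mult_single)

lemma msubst_eq_meval: "msubst = meval mconst"
  by (intro ext) (simp add: msubst_def meval_def mon_eval_def)

lemma (in coeff_hom) meval_msubst:
  "meval h \<sigma> (msubst \<tau> p) = meval h (\<lambda>v. meval h \<sigma> (\<tau> v)) p"
  unfolding msubst_eq_meval
  by (simp add: meval_def[of mconst] meval_def[of h "\<lambda>v. meval h \<sigma> (\<tau> v)"] mon_eval_def meval_sum
      meval_prod meval_power)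

lemma prod_mvar_power: 
  "(\<Prod>v\<in>A. mvar v ^ k v) = Poly_Mapping.single (\<Sum>v\<in>A. Poly_Mapping.single v (k v)) 1"
proof -
  have "mvar v ^ j = Poly_Mapping.single (Poly_Mapping.single v j) 1" for v j
    by (induction j) (simp_all add: mvar_def mult_single flip: single_add)
  thus ?thesis
    by (induction A rule: infinite_finite_induct) (simp_all add: mult_single)
qed

lemma meval_mvar_id: "meval mconst mvar p = p"
  unfolding meval_def mon_eval_def prod_mvar_power poly_mapping_eq_sum_single
  by (simp add: mconst_def mult_single poly_mapping_eq_sum_single)

text \<open>The factor \<open>x\<close> shifts the coefficients, and 0 stands in for the coefficient
  of index -1. The recurrence drives evaluation of the Vieta coefficients, division by a linear
  factor, and the linear form of each coefficient of \<open>f\<close> in one root.\<close>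

lemma coeff_linear_mult:
  "coeff ([:- a, 1:] * p) i = (case i of 0 \<Rightarrow> 0 | Suc j \<Rightarrow> coeff p j) - a * coeff p i"
  for a :: "'a::comm_ring_1"
  by (simp add: coeff_pCons split: nat.splits)

lemma (in coeff_hom) meval_vieta_coeff:
  "meval h \<sigma> (vieta_coeff n i) = coeff (\<Prod>k<n. [:- \<sigma> k, 1:]) i"
  unfolding vieta_coeff_def
proof (induction n arbitrary: i)
  case 0
  show ?case by (cases i) auto
next
  case (Suc n)
  have IH: "meval h \<sigma> (coeff (\<Prod>k<n. [:- mvar k, 1:]) j) = coeff (\<Prod>k<n. [:- \<sigma> k, 1:]) j" for j
    by (rule Suc.IH)
  show ?case
    unfolding prod.lessThan_Suc mult.commute[of _ "[:_, 1:]"] coeff_linear_mult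
    by (cases i) (simp_all add: IH)
qed

lemma degree_prod_linear: "degree (\<Prod>k\<in>A. [:- a k, 1:]) = card A"
  for a :: "_ \<Rightarrow> 'a::idom"
  by (cases "finite A") (auto simp: degree_prod_eq_sum_degree)

lemma monic_prod_linear: "lead_coeff (\<Prod>k\<in>A. [:- a k, 1:]) = 1"
  for a :: "_ \<Rightarrow> 'a::idom"
  by (simp add: lead_coeff_prod)

section \<open>Symmetric polynomials\<close>

inductive_set subring_gen :: "'a::comm_ring_1 set \<Rightarrow> 'a set" for X where
  one: "1 \<in> subring_gen X"
| gen: "x \<in> X \<Longrightarrow> x \<in> subring_gen X"
| diff: "x \<in> subring_gen X \<Longrightarrow> y \<in> subring_gen X \<Longrightarrow> x - y \<in> subring_gen X"
| mult: "x \<in> subring_gen X \<Longrightarrow> y \<in> subring_gen X \<Longrightarrow> x * y \<in> subring_gen X"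

lemma subring_gen_0: "0 \<in> subring_gen X"
  using subring_gen.diff[OF subring_gen.one subring_gen.one] by simp

lemma subring_gen_add: "x \<in> subring_gen X \<Longrightarrow> y \<in> subring_gen X \<Longrightarrow> x + y \<in> subring_gen X"
  using subring_gen.diff[OF _ subring_gen.diff[OF subring_gen_0], of x X y] by simp

lemma subring_gen_sum: "(\<And>i. i \<in> A \<Longrightarrow> f i \<in> subring_gen X) \<Longrightarrow> (\<Sum>i\<in>A. f i) \<in> subring_gen X"
  by (induction A rule: infinite_finite_induct) (auto intro: subring_gen_0 subring_gen_add)

lemma subring_gen_power: "x \<in> subring_gen X \<Longrightarrow> x ^ k \<in> subring_gen X"
  by (induction k) (auto intro: subring_gen.intros)

lemma subring_gen_prod: "(\<And>i. i \<in> A \<Longrightarrow> f i \<in> subring_gen X) \<Longrightarrow> (\<Prod>i\<in>A. f i) \<in> subring_gen X"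
  by (induction A rule: infinite_finite_induct) (auto intro: subring_gen.intros)

lemma subring_gen_mono: "x \<in> subring_gen X \<Longrightarrow> X \<subseteq> Y \<Longrightarrow> x \<in> subring_gen Y"
  by (induction rule: subring_gen.induct) (auto intro: subring_gen.intros)

text \<open>Polynomials with coefficients in the subring are closed under differences and products,
  so their values at \<open>r\<close> exhaust the ring obtained by adjoining
  \<open>r\<close>.\<close>

lemma subring_gen_insert_poly:
  assumes "y \<in> subring_gen (insert r X)"
  shows "\<exists>q. (\<forall>i. coeff q i \<in> subring_gen X) \<and> y = poly q r"
  using assms
proof (induction rule: subring_gen.induct)
  case one
  show ?case
    by (intro exI[of _ 1]) (auto simp: coeff_1 intro: subring_gen.one subring_gen_0)
next
  case (gen x)
  show ?case
  proof (cases "x = r")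
    case True
    thus ?thesis
      by (intro exI[of _ "[:0, 1:]"])
        (auto simp: coeff_pCons split: nat.splits intro: subring_gen.one subring_gen_0)
  next
    case False
    with gen show ?thesis
      by (intro exI[of _ "[:x:]"])
        (auto simp: coeff_pCons split: nat.splits intro: subring_gen.gen subring_gen_0)
  qed
next
  case (diff x y)
  then obtain p q where "\<forall>i. coeff p i \<in> subring_gen X" "x = poly p r"
    "\<forall>i. coeff q i \<in> subring_gen X" "y = poly q r" by blast
  thus ?case by (intro exI[of _ "p - q"]) (auto intro: subring_gen.diff)
next
  case (mult x y)
  then obtain p q where "\<forall>i. coeff p i \<in> subring_gen X" "x = poly p r"
    "\<forall>i. coeff q i \<in> subring_gen X" "y = poly q r" by blast
  thus ?case
    by (intro exI[of _ "p * q"]) (auto simp: coeff_mult intro!: subring_gen_sum subring_gen.mult)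
qed

text \<open>Division with remainder, run as Horner's scheme along \<open>q\<close>: multiplying the
  previous remainder by the indeterminate raises its degree to at most \<open>degree g\<close>, and
  subtracting one multiple of \<open>g\<close> restores the bound. As \<open>g\<close> is monic, no
  coefficient is ever divided.\<close>

lemma reduce_mod_monic:
  fixes g q :: "'a::idom poly"
  assumes g: "\<And>i. coeff g i \<in> subring_gen X" "lead_coeff g = 1" "degree g > 0" "poly g r = 0"
    and q: "\<And>i. coeff q i \<in> subring_gen X"
  shows "\<exists>q'. (\<forall>i. coeff q' i \<in> subring_gen X) \<and> degree q' < degree g \<and> poly q' r = poly q r"
  using q
proof (induction q)
  case 0
  show ?case using g(3) by (intro exI[of _ 0]) (auto intro: subring_gen_0)
next
  case (pCons a q)
  have "coeff q i \<in> subring_gen X" for i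
    using pCons.prems[of "Suc i"] by simp
  then obtain q' where q': "\<And>i. coeff q' i \<in> subring_gen X" "degree q' < degree g" "poly q' r = poly q r"
    using pCons.IH by blast
  let ?p = "pCons a q'"
  have p: "coeff ?p i \<in> subring_gen X" for i
    using q'(1) pCons.prems[of 0] by (auto simp: coeff_pCons split: nat.splits)
  let ?q = "?p - smult (coeff ?p (degree g)) g"
  have deg: "coeff ?q i = 0" if "i \<ge> degree g" for i
  proof (cases "i = degree g")
    case True
    thus ?thesis using g(2) by simp
  next
    case False
    hence "coeff g i = 0" "coeff ?p i = 0"
      using that q'(2) by (auto simp: coeff_pCons coeff_eq_0 split: nat.splits)
    thus ?thesis by simp
  qed
  \<comment> \<open>If \<open>?q\<close> is zero its degree is 0, and the strict bound then rests on
    \<open>degree g > 0\<close>.\<close>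
  have "degree ?q < degree g"
    by (rule degree_lessI) (use deg g(3) in blast)+
  moreover have "coeff ?q i \<in> subring_gen X" for i
    unfolding coeff_diff coeff_smult by (intro subring_gen.intros p g)
  moreover have "poly ?q r = poly (pCons a q) r"
    using q'(3) g(4) by simp
  ultimately show ?case by blast
qed

text \<open>Synthetic division from the top: coefficient \<open>i\<close> of \<open>h\<close> is
  coefficient \<open>i + 1\<close> of the product plus \<open>r\<close> times coefficient
  \<open>i + 1\<close> of \<open>h\<close>.\<close>

lemma coeffs_linear_cofactor:
  fixes h :: "'a::comm_ring_1 poly"
  assumes r: "r \<in> subring_gen X" and c: "\<And>i. coeff ([:- r, 1:] * h) i \<in> subring_gen X"
  shows "coeff h i \<in> subring_gen X"
proof -
  \<comment> \<open>Induction on \<open>j\<close> is descent on \<open>i\<close>, starting above the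
    degree, where the coefficients are 0.\<close>
  have "coeff h i \<in> subring_gen X" if "degree h < i + j" for i j
    using that
  proof (induction j arbitrary: i)
    case 0
    thus ?case by (simp add: coeff_eq_0 subring_gen_0)
  next
    case (Suc j)
    have "coeff h (Suc i) \<in> subring_gen X"
      using Suc by simp
    hence "coeff ([:- r, 1:] * h) (Suc i) + r * coeff h (Suc i) \<in> subring_gen X"
      by (intro subring_gen_add subring_gen.mult r c)
    thus ?case by (simp add: coeff_linear_mult del: mult_pCons_left)
  qed
  from this[of i "Suc (degree h)"] show ?thesis by simp
qed

section \<open>The fundamental theorem on symmetric polynomials\<close>

definition vieta_gens :: "nat \<Rightarrow> nat \<Rightarrow> mpoly set" where
  "vieta_gens n m = range mconst \<union> mvar ` {..<m} \<union> vieta_coeff n ` {..<n}"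

lemma vieta_gens_Suc: "vieta_gens n (Suc m) = insert (mvar m) (vieta_gens n m)"
  by (auto simp: vieta_gens_def lessThan_Suc)

text \<open>The tail product is \<open>f\<close> divided by its first \<open>m\<close> linear
  factors. The base case is \<open>f\<close> itself, whose coefficients are generators or constants;
  each further division is synthetic division by a root just adjoined.\<close>

lemma coeffs_tail_in_subring_gen:
  assumes "m \<le> n"
  shows "coeff (\<Prod>k\<in>{m..<n}. [:- mvar k, 1:]) i \<in> subring_gen (vieta_gens n m)"
  using assms
proof (induction m arbitrary: i)
  case 0
  show ?case
  proof (cases "i < n")
    case True
    hence "vieta_coeff n i \<in> subring_gen (vieta_gens n 0)"
      by (intro subring_gen.gen) (auto simp: vieta_gens_def)
    thus ?thesis by (simp add: vieta_coeff_def atLeast0LessThan)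
  next
    case False
    have d: "degree (\<Prod>k\<in>{0..<n}. [:- mvar k, 1:]) = n"
      by (simp add: degree_prod_linear)
    show ?thesis
    proof (cases "i = n")
      case True
      thus ?thesis
        using monic_prod_linear[of mvar "{0..<n}"] unfolding d by (simp add: subring_gen.one)
    next
      case False
      with \<open>\<not> i < n\<close> have "coeff (\<Prod>k\<in>{0..<n}. [:- mvar k, 1:]) i = 0"
        using d by (intro coeff_eq_0) auto
      thus ?thesis by (simp add: subring_gen_0)
    qed
  qed
next
  case (Suc m)
  have eq: "(\<Prod>k\<in>{m..<n}. [:- mvar k, 1:]) = [:- mvar m, 1:] * (\<Prod>k\<in>{Suc m..<n}. [:- mvar k, 1:])"
    using Suc.prems by (intro prod.atLeast_Suc_lessThan) auto
  show ?case
  proof (rule coeffs_linear_cofactor[of "mvar m"])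
    show "mvar m \<in> subring_gen (vieta_gens n (Suc m))"
      by (intro subring_gen.gen) (auto simp: vieta_gens_def)
    show "coeff ([:- mvar m, 1:] * (\<Prod>k\<in>{Suc m..<n}. [:- mvar k, 1:])) i
        \<in> subring_gen (vieta_gens n (Suc m))" for i
      unfolding eq[symmetric]
      using Suc.prems by (intro subring_gen_mono[OF Suc.IH]) (auto simp: vieta_gens_Suc)
  qed
qed

lemma mvar_inject [simp]: "mvar i = mvar j \<longleftrightarrow> i = j"
proof
  assume "mvar i = mvar j"
  hence "Poly_Mapping.keys (mvar i) = Poly_Mapping.keys (mvar j)" by simp
  hence "Poly_Mapping.keys (Poly_Mapping.single i (1::nat)) = Poly_Mapping.keys (Poly_Mapping.single j (1::nat))"
    unfolding mvar_def by simp
  thus "i = j" by simp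
qed simp

abbreviation swap_vars :: "nat \<Rightarrow> nat \<Rightarrow> mpoly \<Rightarrow> mpoly" where
  "swap_vars a b \<equiv> meval mconst (\<lambda>v. mvar (transpose a b v))"

lemma swap_vars_vieta_coeff:
  assumes "a < n" "b < n"
  shows "swap_vars a b (vieta_coeff n i) = vieta_coeff n i"
proof -
  have "(\<Prod>k<n. [:- mvar (transpose a b k), 1:]) = (\<Prod>k<n. [:- mvar k, 1:])"
    by (rule prod.reindex_bij_witness[of _ "transpose a b" "transpose a b"])
      (use assms in \<open>auto simp: transpose_def\<close>)
  thus ?thesis unfolding mconst.meval_vieta_coeff by (simp add: vieta_coeff_def)
qed

lemma swap_vars_fixes_subring_gen:
  assumes "p \<in> subring_gen (vieta_gens n m)" "a \<in> {m..<n}" "b \<in> {m..<n}"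
  shows "swap_vars a b p = p"
  using assms(1)
proof (induction rule: subring_gen.induct)
  case (gen x)
  then consider c where "x = mconst c" | j where "j < m" "x = mvar j" | i where "x = vieta_coeff n i"
    by (auto simp: vieta_gens_def)
  thus ?case
    using assms(2,3) by cases (simp_all add: swap_vars_vieta_coeff)
qed auto

text \<open>Reducing modulo the minimal polynomial of the variable \<open>m\<close> over the ring of the smaller
  variables presents \<open>p\<close> as the value of a polynomial of degree less than \<open>n - m\<close> at that variable;
  by invariance the value is \<open>p\<close> at \<open>n - m\<close> distinct points, so the polynomial is constant.\<close>
lemma partially_symmetric_in_subring_gen:
  assumes "m \<le> n" "mvars p \<subseteq> {..<n}"
    and "\<And>a b. a \<in> {m..<n} \<Longrightarrow> b \<in> {m..<n} \<Longrightarrow> swap_vars a b p = p"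
  shows "p \<in> subring_gen (vieta_gens n m)"
  using assms(1,3)
\<comment> \<open>Downward induction on \<open>m\<close>: at \<open>m = n\<close> every root
  variable is a generator, and each step removes one of them at the price of more symmetry.\<close>
proof (induction rule: inc_induct)
  case base
  have "meval mconst mvar p \<in> subring_gen (vieta_gens n n)"
    unfolding meval_def mon_eval_def
  proof (intro subring_gen_sum subring_gen.mult subring_gen_prod subring_gen_power subring_gen.gen)
    fix m v assume "m \<in> Poly_Mapping.keys p" "v \<in> Poly_Mapping.keys m"
    hence "v \<in> {..<n}" using assms(2) by (auto simp: mvars_def)
    thus "mvar v \<in> vieta_gens n n" by (auto simp: vieta_gens_def)
  qed (auto simp: vieta_gens_def)
  thus ?case by (simp add: meval_mvar_id)
next
  case (step m)
  let ?S = "subring_gen (vieta_gens n m)"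
  let ?g = "\<Prod>k\<in>{m..<n}. [:- mvar k, 1:]"
  have "p \<in> subring_gen (vieta_gens n (Suc m))"
    by (rule step.IH) (use step.prems in auto)
  then obtain q0 where q0: "\<And>i. coeff q0 i \<in> ?S" "p = poly q0 (mvar m)"
    unfolding vieta_gens_Suc using subring_gen_insert_poly by blast
  have "poly ?g (mvar m) = 0"
    using step.hyps by (auto simp: poly_prod)
  hence "\<exists>q. (\<forall>i. coeff q i \<in> ?S) \<and> degree q < degree ?g \<and> poly q (mvar m) = poly q0 (mvar m)"
    using step.hyps by (intro reduce_mod_monic coeffs_tail_in_subring_gen monic_prod_linear q0)
      (auto simp: degree_prod_linear)
  then obtain q where q: "\<And>i. coeff q i \<in> ?S" "degree q < n - m" "poly q (mvar m) = p"
    using q0(2) by (auto simp: degree_prod_linear)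
  have "poly q (mvar k) = p" if k: "k \<in> {m..<n}" for k
  proof -
    \<comment> \<open>The swap fixes \<open>p\<close> and the coefficients of \<open>q\<close>, yet
      moves the point \<open>mvar m\<close> to \<open>mvar k\<close>.\<close>
    have "p = swap_vars m k (poly q (mvar m))"
      using step.prems[of m k] k step.hyps q(3) by simp
    also have "\<dots> = (\<Sum>i\<le>degree q. swap_vars m k (coeff q i) * mvar k ^ i)"
      by (simp add: poly_altdef mconst.meval_sum mconst.meval_power)
    also have "\<dots> = poly q (mvar k)"
      using k step.hyps by (simp add: swap_vars_fixes_subring_gen[OF q(1)] poly_altdef)
    finally show ?thesis ..
  qed
  moreover have "card (mvar ` {m..<n}) = n - m"
    by (subst card_image) (auto simp: inj_on_def)
  ultimately have "q = [:p:]"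
    using q(2) by (intro poly_eqI_degree[of "mvar ` {m..<n}"]) auto
  with q(1)[of 0] show ?case by simp
qed

section \<open>Variables occurring in a polynomial\<close>

lemma mvars_mconst: "mvars (mconst c) = {}"
  by (auto simp: mvars_def mconst_def)

lemma mvars_mvar: "mvars (mvar v) = {v}"
  by (auto simp: mvars_def mvar_def)

lemma mvars_diff: "mvars (p - q) \<subseteq> mvars p \<union> mvars q"
  using keys_diff[of p q] by (auto simp: mvars_def)

lemma mvars_mult: "mvars (p * q) \<subseteq> mvars p \<union> mvars q"
proof -
  have "Poly_Mapping.keys m \<subseteq> mvars p \<union> mvars q" if m: "m \<in> Poly_Mapping.keys (p * q)" for m
  proof -
    obtain a b where "m = a + b" "a \<in> Poly_Mapping.keys p" "b \<in> Poly_Mapping.keys q"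
      using keys_mult[of p q] m by blast
    thus ?thesis using keys_add[of a b] by (auto simp: mvars_def)
  qed
  thus ?thesis by (auto simp: mvars_def)
qed

lemma mvars_prod: "finite A \<Longrightarrow> mvars (\<Prod>x\<in>A. f x) \<subseteq> (\<Union>x\<in>A. mvars (f x))"
proof (induction A rule: finite_induct)
  case empty
  show ?case using mvars_mconst[of 1] by (simp add: mconst_def)
next
  case (insert x A)
  thus ?case using mvars_mult[of "f x" "prod f A"] by auto
qed

text \<open>Substitution is a ring homomorphism hitting every generator, so preimages can be built
  along the generation of \<open>p\<close> while their variables stay below
  \<open>n\<close>.\<close>

lemma subring_gen_vieta_msubst:
  assumes "p \<in> subring_gen (vieta_gens n 0)"
  shows "\<exists>D. mvars D \<subseteq> {..<n} \<and> msubst (vieta_coeff n) D = p"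
  using assms unfolding msubst_eq_meval
proof (induction rule: subring_gen.induct)
  case one
  have "mvars 1 = {}"
    using mvars_mconst[of 1] by (simp add: mconst_def)
  thus ?case by (intro exI[of _ 1]) simp
next
  case (gen x)
  then consider c where "x = mconst c" | i where "i < n" "x = vieta_coeff n i"
    by (auto simp: vieta_gens_def)
  thus ?case
  proof cases
    case 1
    thus ?thesis by (intro exI[of _ x]) (simp add: mvars_mconst)
  next
    case (2 i)
    thus ?thesis by (intro exI[of _ "mvar i"]) (simp add: mvars_mvar)
  qed
next
  case (diff x y)
  then obtain D E where "mvars D \<subseteq> {..<n}" "meval mconst (vieta_coeff n) D = x"
    "mvars E \<subseteq> {..<n}" "meval mconst (vieta_coeff n) E = y" by blast
  thus ?case using mvars_diff[of D E] by (intro exI[of _ "D - E"]) auto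
next
  case (mult x y)
  then obtain D E where "mvars D \<subseteq> {..<n}" "meval mconst (vieta_coeff n) D = x"
    "mvars E \<subseteq> {..<n}" "meval mconst (vieta_coeff n) E = y" by blast
  thus ?case using mvars_mult[of D E] by (intro exI[of _ "D * E"]) auto
qed

text \<open>Transpositions generate the symmetric group, so the second assumption is full symmetry;
  this is the bottom rung \<open>m = 0\<close>, with no root adjoined.\<close>

theorem symmetric_polynomial_vieta:
  assumes "mvars p \<subseteq> {..<n}" "\<And>a b. a < n \<Longrightarrow> b < n \<Longrightarrow> swap_vars a b p = p"
  shows "\<exists>D. mvars D \<subseteq> {..<n} \<and> msubst (vieta_coeff n) D = p"
  using assms by (intro subring_gen_vieta_msubst partially_symmetric_in_subring_gen) auto

section \<open>The root product as a symmetric polynomial\<close>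

definition D2_triples :: "nat \<Rightarrow> (nat \<times> nat \<times> nat) set" where
  "D2_triples n = {(i, j, k). i < j \<and> j < n \<and> k < n \<and> k \<noteq> i \<and> k \<noteq> j}"

lemma D2_roots_alt: "D2_roots n = (\<Prod>(i, j, k)\<in>D2_triples n. 2 * mvar k - mvar i - mvar j)"
  by (simp add: D2_roots_def D2_triples_def)

lemma finite_D2_triples: "finite (D2_triples n)"
  by (rule finite_subset[of _ "{..<n} \<times> {..<n} \<times> {..<n}"]) (auto simp: D2_triples_def)

lemma swap_vars_D2_roots:
  assumes "a < n" "b < n"
  shows "swap_vars a b (D2_roots n) = D2_roots n"
proof -
  let ?t = "transpose a b"
  \<comment> \<open>A transposition can reverse \<open>i < j\<close>, hence the sorting by
    \<open>min\<close> and \<open>max\<close>; it is harmless because the factor is symmetric in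
    \<open>i\<close> and \<open>j\<close>. The map is an involution on the triples.\<close>
  let ?w = "\<lambda>(i, j, k). (min (?t i) (?t j), max (?t i) (?t j), ?t k)"
  have t: "?t i < n \<longleftrightarrow> i < n" "?t i = ?t j \<longleftrightarrow> i = j" for i j
    using assms by (auto simp: transpose_def)
  have w: "?w x \<in> D2_triples n \<and> ?w (?w x) = x" if xT: "x \<in> D2_triples n" for x
  proof -
    obtain i j k where x: "x = (i, j, k)" "i < j" "j < n" "k < n" "k \<noteq> i" "k \<noteq> j"
      using xT by (auto simp: D2_triples_def)
    hence "?t i \<noteq> ?t j" "?t i < n" "?t j < n" "?t k < n" "?t k \<noteq> ?t i" "?t k \<noteq> ?t j"
      by (auto simp: t)
    with x show ?thesis
      by (cases "?t i < ?t j") (auto simp: D2_triples_def)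
  qed
  have e: "(case ?w x of (i, j, k) \<Rightarrow> 2 * mvar k - mvar i - mvar j)
      = swap_vars a b (case x of (i, j, k) \<Rightarrow> 2 * mvar k - mvar i - mvar j)" for x
  proof (cases x)
    case (fields i j k)
    thus ?thesis by (cases "?t i \<le> ?t j") simp_all
  qed
  show ?thesis
    unfolding D2_roots_alt mconst.meval_prod
    by (rule prod.reindex_bij_witness[where i = ?w and j = ?w])
      (rule w[THEN conjunct1] w[THEN conjunct2] e; assumption)+
qed

lemma mvars_D2_roots: "mvars (D2_roots n) \<subseteq> {..<n}"
proof -
  have "mvars (2 :: mpoly) = {}"
    using mvars_mconst[of 2] by (simp add: mconst_def)
  hence sub: "mvars (2 * mvar k - mvar i - mvar j) \<subseteq> {i, j, k}" for i j k
    using mvars_diff[of "2 * mvar k - mvar i" "mvar j"] mvars_diff[of "2 * mvar k" "mvar i"]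
      mvars_mult[of 2 "mvar k"]
    by (auto simp: mvars_mvar)
  have "mvars (case x of (i, j, k) \<Rightarrow> 2 * mvar k - mvar i - mvar j) \<subseteq> {..<n}"
    if x: "x \<in> D2_triples n" for x
  proof (cases x)
    case (fields i j k)
    hence "{i, j, k} \<subseteq> {..<n}" using x by (auto simp: D2_triples_def)
    with sub[of k i j] show ?thesis unfolding fields prod.case by (rule order_trans)
  qed
  thus ?thesis
    unfolding D2_roots_alt by (intro order_trans[OF mvars_prod[OF finite_D2_triples]] UN_least)
qed

lemma is_D2_exists: "\<exists>D. is_D2 n D"
  unfolding is_D2_def by (intro symmetric_polynomial_vieta mvars_D2_roots swap_vars_D2_roots)

section \<open>Total degree and specialisation\<close>

lemma base_expansion_less:
  fixes a :: "nat \<Rightarrow> nat"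
  assumes "\<And>v. v < n \<Longrightarrow> a v < B"
  shows "(\<Sum>v<n. a v * B ^ v) < B ^ n"
  using assms
proof (induction n)
  case (Suc n)
  have "(\<Sum>v<n. a v * B ^ v) < B ^ n" using Suc by simp
  moreover have "a n * B ^ n + B ^ n \<le> B * B ^ n"
    using mult_right_mono[of "Suc (a n)" B "B ^ n"] Suc.prems[of n] by simp
  ultimately show ?case by simp
qed simp

lemma base_expansion_unique:
  fixes a b :: "nat \<Rightarrow> nat"
  assumes "\<And>v. v < n \<Longrightarrow> a v < B" "\<And>v. v < n \<Longrightarrow> b v < B"
    and "(\<Sum>v<n. a v * B ^ v) = (\<Sum>v<n. b v * B ^ v)" and "v < n"
  shows "a v = b v"
  using assms
proof (induction n arbitrary: v)
  case (Suc n)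
  let ?A = "\<Sum>v<n. a v * B ^ v" and ?B = "\<Sum>v<n. b v * B ^ v"
  have lt: "?A < B ^ n" "?B < B ^ n"
    using Suc.prems by (auto intro!: base_expansion_less)
  have nz: "B ^ n \<noteq> 0" using lt by linarith
  have eq: "?A + a n * B ^ n = ?B + b n * B ^ n"
    using Suc.prems(3) by simp
  from arg_cong[OF eq, of "\<lambda>x. x div B ^ n"] have n: "a n = b n"
    using lt by (simp only: div_mult_self1[OF nz] div_less[OF lt(1)] div_less[OF lt(2)] add_0_right)
  with eq have "?A = ?B" by simp
  hence "a v = b v" if "v < n" for v
    using Suc.IH[of v] Suc.prems(1,2) that by simp
  with n show ?case using Suc.prems(4) by (auto simp: less_Suc_eq)
qed simp

text \<open>Kronecker substitution: \<open>c v = t ^ (B ^ v)\<close> for a large base \<open>B\<close> keeps the monomials apart.\<close>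
lemma exists_nonvanishing_point:
  fixes a :: "(nat \<Rightarrow>\<^sub>0 nat) \<Rightarrow> 'a::field_char_0"
  assumes "finite S" "S \<noteq> {}" "\<And>m. m \<in> S \<Longrightarrow> a m \<noteq> 0"
  shows "\<exists>c. (\<Sum>m\<in>S. a m * mon_eval c m) \<noteq> 0 \<and> (\<forall>v. c v \<noteq> 0)"
proof -
  let ?V = "\<Union>m\<in>S. Poly_Mapping.keys m"
  have "finite ?V" using assms(1) by auto
  then obtain n where "\<And>v. v \<in> ?V \<Longrightarrow> v < n"
    unfolding finite_nat_set_iff_bounded by blast
  hence n: "Poly_Mapping.keys m \<subseteq> {..<n}" if "m \<in> S" for m
    using that by blast
  have "finite (\<Union>m\<in>S. Poly_Mapping.lookup m ` {..<n})" using assms(1) by auto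
  then obtain B where "\<And>k. k \<in> (\<Union>m\<in>S. Poly_Mapping.lookup m ` {..<n}) \<Longrightarrow> k < B"
    unfolding finite_nat_set_iff_bounded by blast
  hence B: "Poly_Mapping.lookup m v < B" if "m \<in> S" "v < n" for m v
    using that by blast
  \<comment> \<open>The exponent of \<open>t\<close> that a monomial receives, read as a base
    \<open>B\<close> numeral whose digits are the exponents of the monomial.\<close>
  define w where "w = (\<lambda>m. \<Sum>v<n. Poly_Mapping.lookup m v * B ^ v)"
  have inj: "m = m'" if m: "m \<in> S" "m' \<in> S" "w m = w m'" for m m'
  proof (rule poly_mapping_eqI)
    fix v
    show "Poly_Mapping.lookup m v = Poly_Mapping.lookup m' v"
    proof (cases "v < n")
      case True
      show ?thesis
        by (rule base_expansion_unique[where B = B and n = n]) (use m B True in \<open>auto simp: w_def\<close>)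
    next
      case False
      hence "v \<notin> Poly_Mapping.keys m" "v \<notin> Poly_Mapping.keys m'"
        using n[OF m(1)] n[OF m(2)] by auto
      thus ?thesis by (simp add: in_keys_iff)
    qed
  qed
  define P where "P = (\<Sum>m\<in>S. monom (a m) (w m))"
  obtain m0 where m0: "m0 \<in> S" using assms(2) by blast
  have "coeff P (w m0) = (\<Sum>m\<in>S. if m = m0 then a m else 0)"
    unfolding P_def coeff_sum using inj m0 by (intro sum.cong) auto
  also have "\<dots> = a m0" using assms(1) m0 by simp
  finally have "P \<noteq> 0" using assms(3)[OF m0] by auto
  \<comment> \<open>The extra factor of the indeterminate forces \<open>t\<close> itself to be
    nonzero, and with it every coordinate of the point.\<close>
  hence "pCons 0 P \<noteq> 0" by simp
  then obtain t where t: "poly (pCons 0 P) t \<noteq> 0"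
    using poly_all_0_iff_0 by blast
  have "mon_eval (\<lambda>v. t ^ (B ^ v)) m = t ^ w m" if "m \<in> S" for m
    by (simp add: mon_eval_superset[OF _ n[OF that]] w_def power_sum mult.commute flip: power_mult)
  hence "(\<Sum>m\<in>S. a m * mon_eval (\<lambda>v. t ^ (B ^ v)) m) = poly P t"
    by (simp add: P_def poly_sum poly_monom)
  with t show ?thesis
    by (intro exI[of _ "\<lambda>v. t ^ (B ^ v)"]) auto
qed

section \<open>Coefficients at the degree bound of products and monomials\<close>

lemma coeff_mult_le:
  fixes p q :: "'a::comm_ring_1 poly"
  assumes "degree p \<le> i" "degree q \<le> j"
  shows "coeff (p * q) (i + j) = coeff p i * coeff q j"
proof -
  have "coeff (p * q) (i + j) = (\<Sum>k\<le>i + j. if k = i then coeff p i * coeff q j else 0)"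
    unfolding coeff_mult
  proof (intro sum.cong refl)
    fix k
    show "coeff p k * coeff q (i + j - k) = (if k = i then coeff p i * coeff q j else 0)"
    proof (cases k i rule: linorder_cases)
      case less
      hence "coeff q (i + j - k) = 0" using assms(2) by (intro coeff_eq_0) auto
      thus ?thesis using less by simp
    next
      case greater
      hence "coeff p k = 0" using assms(1) by (intro coeff_eq_0) auto
      thus ?thesis using greater by simp
    qed simp
  qed
  thus ?thesis by simp
qed

lemma coeff_power_le:
  fixes p :: "'a::comm_ring_1 poly"
  assumes "degree p \<le> 1"
  shows "degree (p ^ k) \<le> k \<and> coeff (p ^ k) k = coeff p 1 ^ k"
proof (induction k)
  case (Suc k)
  show ?case
    using coeff_mult_le[OF assms, of "p ^ k" k] degree_mult_le[of p "p ^ k"] assms Suc by simp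
qed simp

lemma coeff_prod_le:
  fixes f :: "'b \<Rightarrow> 'a::comm_ring_1 poly"
  assumes "finite A" "\<And>x. x \<in> A \<Longrightarrow> degree (f x) \<le> k x"
  shows "degree (\<Prod>x\<in>A. f x) \<le> (\<Sum>x\<in>A. k x) \<and> coeff (\<Prod>x\<in>A. f x) (\<Sum>x\<in>A. k x) = (\<Prod>x\<in>A. coeff (f x) (k x))"
  using assms
proof (induction A rule: finite_induct)
  case (insert x A)
  hence "degree (f x) \<le> k x" "degree (prod f A) \<le> sum k A" by auto
  moreover from this have "degree (f x * prod f A) \<le> k x + sum k A"
    using degree_mult_le[of "f x" "prod f A"] by linarith
  ultimately show ?case
    using coeff_mult_le[of "f x" "k x" "prod f A" "sum k A"] insert by simp
qed simp

text \<open>Each variable contributes at most one degree, so only the slopes \<open>b v\<close>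
  enter the coefficient at \<open>mon_deg m\<close>. Working with bounds instead of exact degrees
  allows slopes to vanish.\<close>

lemma mon_eval_linear:
  fixes a b :: "nat \<Rightarrow> 'a::comm_ring_1"
  shows "degree (mon_eval (\<lambda>v. [:a v, b v:]) m) \<le> mon_deg m"
    and "coeff (mon_eval (\<lambda>v. [:a v, b v:]) m) (mon_deg m) = mon_eval b m"
proof -
  have "degree ([:a v, b v:] ^ Poly_Mapping.lookup m v) \<le> Poly_Mapping.lookup m v \<and>
    coeff ([:a v, b v:] ^ Poly_Mapping.lookup m v) (Poly_Mapping.lookup m v) = b v ^ Poly_Mapping.lookup m v" for v
    using coeff_power_le[of "[:a v, b v:]" "Poly_Mapping.lookup m v"] by simp
  thus "degree (mon_eval (\<lambda>v. [:a v, b v:]) m) \<le> mon_deg m"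
    and "coeff (mon_eval (\<lambda>v. [:a v, b v:]) m) (mon_deg m) = mon_eval b m"
    using coeff_prod_le[of "Poly_Mapping.keys m" "\<lambda>v. [:a v, b v:] ^ Poly_Mapping.lookup m v" "Poly_Mapping.lookup m"]
    unfolding mon_eval_def mon_deg_def by simp_all
qed

lemma mon_eval_scale: "mon_eval (\<lambda>v. s * x v) m = s ^ mon_deg m * mon_eval x m"
  by (simp add: mon_eval_def mon_deg_def power_mult_distrib prod.distrib power_sum)

lemma mon_deg_le_total_degree: "m \<in> Poly_Mapping.keys p \<Longrightarrow> mon_deg m \<le> total_degree p"
  unfolding total_degree_def by (intro Max_ge) auto

lemma total_degree_attained:
  assumes "p \<noteq> 0"
  shows "\<exists>m\<in>Poly_Mapping.keys p. mon_deg m = total_degree p"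
proof -
  obtain m where m: "m \<in> Poly_Mapping.keys p"
    using assms by (metis all_not_in_conv keys_eq_empty)
  have "total_degree p \<in> insert 0 (mon_deg ` Poly_Mapping.keys p)"
    unfolding total_degree_def by (intro Max_in) auto
  thus ?thesis
    using m mon_deg_le_total_degree[OF m] by auto
qed

section \<open>Specialising all roots but one\<close>

interpretation cpoly: coeff_hom "\<lambda>c. [:of_rat c:] :: complex poly"
  by standard (simp_all add: of_rat_add of_rat_mult one_pCons)

text \<open>Root 0 stays free as the indeterminate; the remaining roots become constants, with
  indices shifted down by one.\<close>

definition specialise :: "(nat \<Rightarrow> complex) \<Rightarrow> mpoly \<Rightarrow> complex poly" where
  "specialise z = meval (\<lambda>c. [:of_rat c:]) (\<lambda>v. case v of 0 \<Rightarrow> [:0, 1:] | Suc k \<Rightarrow> [:z k:])"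

lemma coeff_prod_linear_const:
  "coeff (\<Prod>k<m. [:- [:z k:], 1:]) i = [:coeff (\<Prod>k<m. [:- z k, 1:]) i:]"
  for z :: "nat \<Rightarrow> 'a::comm_ring_1"
proof (induction m arbitrary: i)
  case 0
  show ?case by (cases i) (auto simp: one_pCons)
next
  case (Suc m)
  show ?case
    unfolding prod.lessThan_Suc mult.commute[of _ "[:_, 1:]"] coeff_linear_mult Suc.IH
    by (cases i) simp_all
qed

lemma specialise_vieta_coeff:
  "specialise z (vieta_coeff (Suc m) i) =
    [:case i of 0 \<Rightarrow> 0 | Suc j \<Rightarrow> coeff (\<Prod>k<m. [:- z k, 1:]) j, - coeff (\<Prod>k<m. [:- z k, 1:]) i:]"
  unfolding specialise_def cpoly.meval_vieta_coeff prod.lessThan_Suc_shift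
  by (simp only: nat.case coeff_linear_mult coeff_prod_linear_const)
    (simp split: nat.split)

text \<open>Every Vieta coefficient becomes linear in the free root, so a monomial of
  \<open>D\<close> reaches at most its own degree and only those of maximal degree meet the top
  slot.\<close>

lemma specialise_msubst_vieta:
  fixes D :: mpoly and z :: "nat \<Rightarrow> complex" and m :: nat
  defines "P \<equiv> specialise z (msubst (vieta_coeff (Suc m)) D)"
  shows "degree P \<le> total_degree D"
    and "coeff P (total_degree D) =
      (\<Sum>u\<in>{u\<in>Poly_Mapping.keys D. mon_deg u = total_degree D}. of_rat (Poly_Mapping.lookup D u) *
        mon_eval (\<lambda>v. - coeff (\<Prod>k<m. [:- z k, 1:]) v) u)"
proof -
  let ?b = "\<lambda>v. - coeff (\<Prod>k<m. [:- z k, 1:]) v"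
  let ?a = "\<lambda>v. case v of 0 \<Rightarrow> 0 | Suc j \<Rightarrow> coeff (\<Prod>k<m. [:- z k, 1:]) j"
  let ?s = "\<lambda>v. [:?a v, ?b v:]"
  have "P = meval (\<lambda>c. [:of_rat c:]) ?s D"
    using specialise_vieta_coeff[of z m] unfolding P_def specialise_def cpoly.meval_msubst by simp
  hence P: "P = (\<Sum>u\<in>Poly_Mapping.keys D. smult (of_rat (Poly_Mapping.lookup D u)) (mon_eval ?s u))"
    by (simp add: meval_def)
  show "degree P \<le> total_degree D"
    unfolding P
    by (intro degree_sum_le order.trans[OF degree_smult_le] order.trans[OF mon_eval_linear(1)]
        mon_deg_le_total_degree) auto
  have c: "coeff (mon_eval ?s u) (total_degree D) = (if mon_deg u = total_degree D then mon_eval ?b u else 0)"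
    if "u \<in> Poly_Mapping.keys D" for u
  proof (cases "mon_deg u = total_degree D")
    case True
    thus ?thesis using mon_eval_linear(2)[of ?a ?b u] by simp
  next
    case False
    hence "degree (mon_eval ?s u) < total_degree D"
      using mon_eval_linear(1)[of ?a ?b u] mon_deg_le_total_degree[OF that] by linarith
    thus ?thesis using False by (simp add: coeff_eq_0)
  qed
  show "coeff P (total_degree D) =
      (\<Sum>u\<in>{u\<in>Poly_Mapping.keys D. mon_deg u = total_degree D}. of_rat (Poly_Mapping.lookup D u) * mon_eval ?b u)"
    unfolding P coeff_sum
    by (rule sum.mono_neutral_cong_right) (auto simp: c)
qed

text \<open>The fundamental theorem of algebra, with the multiset of roots listed by index. It
  allows the lower coefficients of the remaining factor to be prescribed freely.\<close>

lemma monic_complex_poly_factors: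
  fixes p :: "complex poly"
  assumes "lead_coeff p = 1"
  shows "\<exists>z. p = (\<Prod>k<degree p. [:- z k, 1:])"
proof -
  have "p \<noteq> 0" using assms by auto
  then obtain A where A: "size A = degree p" "p = (\<Prod>x\<in>#A. [:- x, 1:])"
    using alg_closed_imp_factorization[of p] assms by auto
  obtain xs where xs: "mset xs = A" using ex_mset by blast
  have "p = prod_list (map (\<lambda>x. [:- x, 1:]) xs)"
    using A(2) xs by (metis mset_map prod_mset_prod_list)
  also have "\<dots> = (\<Prod>k<length xs. [:- (xs ! k), 1:])"
    by (simp add: prod.list_conv_set_nth atLeast0LessThan)
  also have "length xs = degree p" using A(1) xs by auto
  finally show ?thesis by (intro exI[of _ "\<lambda>k. xs ! k"])
qed

lemma exists_specialisation_of_total_degree: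
  assumes "D \<noteq> 0" "mvars D \<subseteq> {..<Suc m}"
  shows "\<exists>z. degree (specialise z (msubst (vieta_coeff (Suc m)) D)) = total_degree D"
proof -
  let ?S = "{u\<in>Poly_Mapping.keys D. mon_deg u = total_degree D}"
  let ?c = "\<lambda>u. of_rat (Poly_Mapping.lookup D u) :: complex"
  have "?S \<noteq> {}" using total_degree_attained[OF assms(1)] by auto
  moreover have "finite ?S" by auto
  ultimately obtain x where x: "(\<Sum>u\<in>?S. ?c u * mon_eval x u) \<noteq> 0" "\<And>v. x v \<noteq> 0"
    using exists_nonvanishing_point[of ?S ?c] by (auto simp: in_keys_iff)
  \<comment> \<open>A monic polynomial whose coefficients are proportional to the chosen point
    \<open>x\<close>; dividing by \<open>x m\<close> is why all coordinates were required to be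
    nonzero.\<close>
  define G where "G = (\<Sum>v\<le>m. monom (x v / x m) v)"
  have G: "coeff G v = (if v \<le> m then x v / x m else 0)" for v
    unfolding G_def coeff_sum coeff_monom by simp
  have dG: "degree G = m"
    using x(2) by (intro order.antisym degree_le le_degree) (auto simp: G)
  hence "lead_coeff G = 1" using x(2) by (simp add: G)
  then obtain z where z: "G = (\<Prod>k<m. [:- z k, 1:])"
    using monic_complex_poly_factors dG by blast
  \<comment> \<open>The negated coefficients are \<open>x\<close> scaled by
    \<open>- 1 / x m\<close>. All monomials in \<open>?S\<close> have the same degree, so the top
    part only picks up a common nonzero factor.\<close>
  have "mon_eval (\<lambda>v. - coeff G v) u = (- 1 / x m) ^ total_degree D * mon_eval x u" if "u \<in> ?S" for u
  proof -
    have "mon_eval (\<lambda>v. - coeff G v) u = mon_eval (\<lambda>v. - 1 / x m * x v) u"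
      unfolding mon_eval_def
    proof (intro prod.cong refl)
      fix v assume "v \<in> Poly_Mapping.keys u"
      hence "v \<le> m" using that assms(2) by (auto simp: mvars_def)
      thus "(- coeff G v) ^ Poly_Mapping.lookup u v = (- 1 / x m * x v) ^ Poly_Mapping.lookup u v"
        by (simp add: G)
    qed
    thus ?thesis using that by (simp only: mon_eval_scale mem_Collect_eq)
  qed
  hence "(\<Sum>u\<in>?S. ?c u * mon_eval (\<lambda>v. - coeff G v) u)
      = (- 1 / x m) ^ total_degree D * (\<Sum>u\<in>?S. ?c u * mon_eval x u)"
    unfolding sum_distrib_left by (intro sum.cong refl) (simp only: mult.left_commute)
  also have "\<dots> \<noteq> 0" using x by simp
  finally have "coeff (specialise z (msubst (vieta_coeff (Suc m)) D)) (total_degree D) \<noteq> 0"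
    unfolding specialise_msubst_vieta(2) z .
  hence "total_degree D \<le> degree (specialise z (msubst (vieta_coeff (Suc m)) D))"
    by (rule le_degree)
  thus ?thesis
    by (intro exI[of _ z] order.antisym specialise_msubst_vieta(1))
qed

section \<open>The degree of the root product in one root\<close>

text \<open>Root 0 cannot be in position \<open>j\<close>. In position \<open>i\<close> it leaves an
  ordered pair of distinct other roots (\<open>A\<close>), in position \<open>k\<close> an unordered
  one (\<open>B\<close>), so \<open>B\<close> has half the size of \<open>A\<close>.\<close>

lemma card_D2_triples_first:
  "card {(i, j, k)\<in>D2_triples n. i = 0 \<or> k = 0} = 3 * (n - 1) * (n - 2) div 2"
proof (cases n)
  case 0
  hence "{(i, j, k)\<in>D2_triples n. i = 0 \<or> k = 0} = {}" by (auto simp: D2_triples_def)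
  thus ?thesis using 0 by (simp only: card.empty)
next
  case (Suc m)
  define A where "A = {0::nat} \<times> (SIGMA j:{1..m}. {1..m} - {j})"
  define B where "B = (\<lambda>(j, i). (i, j, 0::nat)) ` (SIGMA j:{1..m}. {1..<j})"
  have "{(i, j, k)\<in>D2_triples n. i = 0 \<or> k = 0} = A \<union> B"
    unfolding A_def B_def D2_triples_def Suc by (auto simp: image_iff)
  moreover have "finite A" "finite B" "A \<inter> B = {}"
    by (auto simp: A_def B_def)
  moreover have "card A = m * (m - 1)"
    by (simp add: A_def card_cartesian_product)
  moreover have "2 * card B = m * (m - 1)"
  proof -
    have "card B = card (SIGMA j:{1..m}. {1..<j})"
      unfolding B_def by (intro card_image) (auto simp: inj_on_def)
    also have "\<dots> = (\<Sum>j=1..m. j - 1)" by simp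
    finally have "card B = (\<Sum>j=1..m. j - 1)" .
    moreover have "2 * (\<Sum>j=1..m. j - 1) = m * (m - 1)"
      by (induction m) (auto simp: algebra_simps)
    ultimately show ?thesis by simp
  qed
  ultimately show ?thesis
    using Suc by (simp add: card_Un_disjoint)
qed

text \<open>In a triple \<open>j\<close> is positive and \<open>i\<close>, \<open>k\<close> are not
  both 0, so three cases suffice and every truncated subtraction acts on a positive index. The
  slopes -1 and 2 never vanish.\<close>

lemma specialise_D2_roots:
  "specialise z (D2_roots n) = (\<Prod>(i, j, k)\<in>D2_triples n.
     if i = 0 then [:2 * z (k - 1) - z (j - 1), - 1:]
     else if k = 0 then [:- z (i - 1) - z (j - 1), 2:]
     else [:2 * z (k - 1) - z (i - 1) - z (j - 1):])"
proof -
  have "smult c (2 :: complex poly) = [:2 * c:]" for c by (simp add: numeral_poly)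
  thus ?thesis
    unfolding D2_roots_alt specialise_def cpoly.meval_prod
    by (intro prod.cong) (auto simp: D2_triples_def split: nat.splits)
qed

lemma sum_D2_triples_first:
  "(\<Sum>(i, j, k)\<in>D2_triples n. if i = 0 \<or> k = 0 then 1 else 0) = 3 * (n - 1) * (n - 2) div 2"
proof -
  have "(\<Sum>(i, j, k)\<in>D2_triples n. if i = 0 \<or> k = 0 then 1 else 0)
      = card {x\<in>D2_triples n. case x of (i, j, k) \<Rightarrow> i = 0 \<or> k = 0}"
    using finite_D2_triples[of n] 
    by (simp add: card_eq_sum sum.inter_filter case_prod_unfold del: sum_constant One_nat_def)
  also have "{x\<in>D2_triples n. case x of (i, j, k) \<Rightarrow> i = 0 \<or> k = 0} = {(i, j, k)\<in>D2_triples n. i = 0 \<or> k = 0}"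
    by auto
  finally show ?thesis by (simp only: card_D2_triples_first)
qed

lemma degree_specialise_D2_roots_le:
  "degree (specialise z (D2_roots n)) \<le> 3 * (n - 1) * (n - 2) div 2"
  unfolding specialise_D2_roots sum_D2_triples_first[symmetric]
  by (rule order_trans[OF degree_prod_sum_le[OF finite_D2_triples]])
    (auto simp: case_prod_unfold intro!: sum_mono)

text \<open>A 3-adic argument: for \<open>a < b\<close>, equality would force \<open>a < c\<close>
  by size, and then \<open>3 ^ Suc a\<close> would divide \<open>3 ^ a\<close>.\<close>

lemma two_power3_neq_sum:
  fixes a b c :: nat
  assumes "a \<noteq> b"
  shows "2 * 3 ^ c \<noteq> (3 ^ a + 3 ^ b :: nat)"
proof -
  have "2 * 3 ^ c \<noteq> (3 ^ a + 3 ^ b :: nat)" if "a < b" for a b :: nat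
  proof
    assume eq: "2 * 3 ^ c = (3 ^ a + 3 ^ b :: nat)"
    have lt: "(3::nat) ^ a < 3 ^ b" using that by simp
    have "a < c"
    proof (rule ccontr)
      assume "\<not> a < c"
      hence "(3::nat) ^ c \<le> 3 ^ a" by simp
      with lt eq show False by linarith
    qed
    hence "(3::nat) ^ Suc a dvd 2 * 3 ^ c" "(3::nat) ^ Suc a dvd 3 ^ b"
      using that by (auto intro!: dvd_mult le_imp_power_dvd simp del: power_Suc)
    hence "(3::nat) ^ Suc a dvd 3 ^ a"
      unfolding eq by (simp add: dvd_add_left_iff del: power_Suc)
    hence "(3::nat) ^ Suc a \<le> 3 ^ a" by (intro dvd_imp_le) auto
    thus False by simp
  qed
  from this[of a b] this[of b a] assms show ?thesis
    by (auto simp: add.commute linorder_neq_iff)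
qed

text \<open>Powers of 3 keep the factors free of root 0 nonzero, since no power is the mean of two
  different ones. Hence the degrees of the factors add up exactly.\<close>

lemma degree_specialise_D2_roots:
  "degree (specialise (\<lambda>k. 3 ^ k) (D2_roots n)) = 3 * (n - 1) * (n - 2) div 2"
proof -
  have ne: "2 * 3 ^ c - 3 ^ a \<noteq> (3 ^ b :: complex)" if "a \<noteq> b" for a b c :: nat
  proof
    assume "2 * 3 ^ c - 3 ^ a = (3 ^ b :: complex)"
    hence "of_nat (2 * 3 ^ c) = (of_nat (3 ^ a + 3 ^ b) :: complex)" by (simp add: algebra_simps)
    hence "2 * 3 ^ c = (3 ^ a + 3 ^ b :: nat)" using of_nat_eq_iff by blast
    thus False using two_power3_neq_sum[OF that] by blast
  qed
  have ij: "i - Suc 0 \<noteq> j - Suc 0" if "0 < i" "i < j" for i j :: nat using that by arith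
  show ?thesis
    unfolding specialise_D2_roots sum_D2_triples_first[symmetric]
    by (subst degree_prod_eq_sum_degree)
      (auto simp: D2_triples_def ne ij intro!: sum.cong)
qed

theorem proposition3:
  fixes n :: nat
  assumes "n \<ge> 3"
  shows "(\<exists>D. is_D2 n D) \<and>
         (\<forall>D. is_D2 n D \<longrightarrow> total_degree D = 3 * (n - 1) * (n - 2) div 2)"
proof (intro conjI allI impI is_D2_exists)
  fix D assume D: "is_D2 n D"
  obtain m where m: "n = Suc m" using assms by (cases n) auto
  have vars: "mvars D \<subseteq> {..<Suc m}" and eq: "msubst (vieta_coeff (Suc m)) D = D2_roots n"
    using D by (auto simp: is_D2_def m)
  show "total_degree D = 3 * (n - 1) * (n - 2) div 2"
  proof (rule order.antisym)
    \<comment> \<open>No specialisation exceeds the total degree, and the powers of 3 give one whose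
      degree is the full count.\<close>
    show "3 * (n - 1) * (n - 2) div 2 \<le> total_degree D"
      using specialise_msubst_vieta(1)[of "\<lambda>k. 3 ^ k" m D]
      unfolding eq degree_specialise_D2_roots .
    \<comment> \<open>Conversely some specialisation attains the total degree, while the count
      bounds the degree of every specialisation. For \<open>D = 0\<close> the total degree is 0 by
      convention.\<close>
    show "total_degree D \<le> 3 * (n - 1) * (n - 2) div 2"
    proof (cases "D = 0")
      case True
      thus ?thesis by (simp add: total_degree_def)
    next
      case False
      then obtain z where "degree (specialise z (D2_roots n)) = total_degree D"
        using exists_specialisation_of_total_degree[OF False vars] unfolding eq by blast
      thus ?thesis using degree_specialise_D2_roots_le[of z n] by simp
    qed
  qed
qed

end
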